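(* If $T$ is a nontrivial tree, then $pc_{1,2}(T)=\sigma'_2(T)-1$.
   Context: All graphs are finite, undirected and simple; a tree is nontrivial if it has at least two vertices. For a graph $G$ with at least one edge, $\sigma'_2(G)=\max\{d(x)+d(y): xy\in E(G)\}$ is the largest sum of degrees of two adjacent vertices. An edge-coloring of a graph is an arbitrary map from its edge set to the natural numbers (adjacent edges may share a color). In an edge-colored graph, a path $P$ is a distance $2$-proper path if no two edges of $P$ of the same color appear with fewer than $2$ edges in between on $P$. The number $pc_{1,2}(G)$ is the minimum number of colors in an edge-coloring of the connected graph $G$ such that every pair of distinct vertices of $G$ is connected by at least one distance $2$-proper path. *)

theory Defs
  imports "Graph_Theory.Graph_Theory"
begin

text \<open>
  A finite simple undirected graph is a \<^locale>\<open>pair_graph\<close>: each edge $uv$ is represented by the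
  two arcs $(u,v)$ and $(v,u)$. Hence the degree of a vertex is its \<^const>\<open>out_degree\<close>, and
  paths are the arc paths \<^const>\<open>pre_digraph.apath\<close> (walks without repeated vertices).
  Colors live on the undirected edges, which are the two-element vertex sets below.
\<close>

definition edge_of :: "'a \<times> 'a \<Rightarrow> 'a set" where
  "edge_of a = {fst a, snd a}"

definition uedges :: "'a pair_pre_digraph \<Rightarrow> 'a set set" where
  "uedges G = edge_of ` parcs G"

text \<open>
  The constant \<^const>\<open>tree\<close> of the library is not usable here: it counts the closed walk $u, v, u$
  along the two arcs of one edge as a cycle, so no symmetric digraph with an edge satisfies it.
  In a simple graph the cycles are those of length at least 3.
\<close>

definition undirected_tree :: "'a pair_pre_digraph \<Rightarrow> bool" where
  "undirected_tree T \<longleftrightarrow> pair_graph T \<and> Digraph_Component.connected (with_proj T) \<and>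
     \<not> (\<exists>p. pre_digraph.cycle (with_proj T) p \<and> 3 \<le> length p)"

definition nontrivial_tree :: "'a pair_pre_digraph \<Rightarrow> bool" where
  "nontrivial_tree T \<longleftrightarrow> undirected_tree T \<and> 2 \<le> card (pverts T)"

definition sigma2' :: "'a pair_pre_digraph \<Rightarrow> nat" where
  "sigma2' G =
     Max {out_degree (with_proj G) x + out_degree (with_proj G) y | x y. (x, y) \<in> parcs G}"

text \<open>
  The edges at positions $i < j$ of a path have $j - i - 1$ edges in between.
\<close>

definition distance2_proper :: "('a set \<Rightarrow> nat) \<Rightarrow> ('a \<times> 'a) list \<Rightarrow> bool" where
  "distance2_proper c p \<longleftrightarrow>
     (\<forall>i j. i < j \<and> j < length p \<and> c (edge_of (p ! i)) = c (edge_of (p ! j))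
        \<longrightarrow> \<not> j - i - 1 < 2)"

definition distance2_proper_connected :: "'a pair_pre_digraph \<Rightarrow> ('a set \<Rightarrow> nat) \<Rightarrow> bool" where
  "distance2_proper_connected G c \<longleftrightarrow>
     (\<forall>u \<in> pverts G. \<forall>v \<in> pverts G. u \<noteq> v \<longrightarrow>
        (\<exists>p. pre_digraph.apath (with_proj G) u p v \<and> distance2_proper c p))"

text \<open>
  An edge-coloring is given by an arbitrary function on sets, of which only the values on
  \<^term>\<open>uedges G\<close> matter. For connected finite \<^term>\<open>G\<close> the minimum exists, since
  a coloring that is injective on the edges makes every path distance 2-proper.
\<close>

definition pc12 :: "'a pair_pre_digraph \<Rightarrow> nat" where
  "pc12 G = (LEAST k. \<exists>c. card (c ` uedges G) = k \<and> distance2_proper_connected G c)"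

end

(*
  Paths in a tree are unique, so a coloring is distance 2-proper connected iff any two edges that
  share an endpoint or are joined by an edge have different colors. The d(x) + d(y) - 1 edges
  meeting an edge xy are pairwise in conflict, which gives the lower bound. Coloring greedily
  from a root outwards, the edges in conflict with the new one that are already colored lie among
  the other edges meeting a single edge uw, so sigma2' - 1 colors suffice.
*)

theory Submission
  imports Defs
begin

section \<open>Greedy coloring of a finite conflict relation\<close>

text \<open>Elements are colored by increasing \<open>rank\<close>. When \<open>x\<close> is
  reached, its colored conflict partners have rank at most that of \<open>x\<close>, so they occupy
  fewer than \<open>k\<close> colors and one is free. Ties are counted in the bound, so the order
  among equal ranks is arbitrary.\<close>

lemma greedy_coloring:
  fixes rank :: "'e \<Rightarrow> nat"
  assumes "finite E"
    and sym: "\<And>e f. R e f \<Longrightarrow> R f e"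
    and bound: "\<And>e. e \<in> E \<Longrightarrow> card {f \<in> E. f \<noteq> e \<and> R e f \<and> rank f \<le> rank e} < k"
  shows "\<exists>c. c ` E \<subseteq> {..<k} \<and> (\<forall>e \<in> E. \<forall>f \<in> E. e \<noteq> f \<longrightarrow> R e f \<longrightarrow> c e \<noteq> c f)"
proof -
  have "S \<subseteq> E \<longrightarrow> (\<exists>c. c ` S \<subseteq> {..<k} \<and>
          (\<forall>e \<in> S. \<forall>f \<in> S. e \<noteq> f \<longrightarrow> R e f \<longrightarrow> c e \<noteq> c f))"
    if "finite S" for S
    using that
  proof (induction S rule: finite_ranking_induct[where f = rank])
    case empty
    show ?case by simp
  next
    case (insert x S)
    show ?case
    proof
      assume sub: "insert x S \<subseteq> E"
      then obtain c where c: "c ` S \<subseteq> {..<k}"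
        "\<forall>e \<in> S. \<forall>f \<in> S. e \<noteq> f \<longrightarrow> R e f \<longrightarrow> c e \<noteq> c f"
        using insert.IH by auto
      define N where "N = {f \<in> E. f \<noteq> x \<and> R x f \<and> rank f \<le> rank x}"
      have "finite N" unfolding N_def using \<open>finite E\<close> by simp
      then have "card (c ` N) < card {..<k}"
        using bound[of x] sub card_image_le[of N c] by (simp add: N_def)
      then have "\<not> {..<k} \<subseteq> c ` N"
        using card_mono[of "c ` N" "{..<k}"] \<open>finite N\<close> by auto
      then obtain a where a: "a < k" "a \<notin> c ` N" by auto
      have nb: "f \<in> N" if "f \<in> S" "f \<noteq> x" "R x f" for f
        using that insert.hyps sub by (auto simp: N_def)
      show "\<exists>c. c ` insert x S \<subseteq> {..<k} \<and>
          (\<forall>e \<in> insert x S. \<forall>f \<in> insert x S. e \<noteq> f \<longrightarrow> R e f \<longrightarrow> c e \<noteq> c f)"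
      proof (intro exI[of _ "c(x := a)"] conjI)
        show "(c(x := a)) ` insert x S \<subseteq> {..<k}" using c(1) a(1) by auto
        show "\<forall>e \<in> insert x S. \<forall>f \<in> insert x S. e \<noteq> f \<longrightarrow> R e f \<longrightarrow> (c(x := a)) e \<noteq> (c(x := a)) f"
        proof (intro ballI impI)
          fix e f assume ef: "e \<in> insert x S" "f \<in> insert x S" "e \<noteq> f" "R e f"
          then show "(c(x := a)) e \<noteq> (c(x := a)) f"
            using c(2) a(2) nb[of e] nb[of f] sym[of e f] by auto
        qed
      qed
    qed
  qed
  from this[OF \<open>finite E\<close>] show ?thesis by simp
qed

section \<open>Existence and uniqueness of paths in a tree\<close>

locale tree_graph = pair_graph T for T :: "'a pair_pre_digraph" +
  assumes is_tree: "undirected_tree T"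
begin

lemma ex_apath:
  assumes "u \<in> pverts T" "v \<in> pverts T"
  obtains p where "apath u p v"
proof -
  have "connected (with_proj T)" using is_tree by (simp add: undirected_tree_def)
  then have "strongly_connected (with_proj T)"
    using symmetric_connected_imp_strongly_connected sym_arcs by blast
  then have "u \<rightarrow>\<^sup>*\<^bsub>with_proj T\<^esub> v"
    using assms unfolding strongly_connected_def by auto
  then show ?thesis using that reachable_apath by blast
qed

text \<open>
  If two paths from \<open>u\<close> leave through different neighbours, joining their ends outside \<open>u\<close>
  closes a cycle through \<open>u\<close>.
\<close>

lemma apath_unique: "apath u p v \<Longrightarrow> apath u q v \<Longrightarrow> p = q"
proof (induction p arbitrary: u q)
  case Nil
  then have "u = v" by (simp add: apath_Nil_iff)
  then show ?case using Nil.prems(2) apath_nonempty_ends by blast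
next
  case (Cons e p)
  have "q \<noteq> []"
    using apath_nonempty_ends[OF Cons.prems(1)] Cons.prems(2) by (auto simp: apath_Nil_iff)
  then obtain f q' where q: "q = f # q'" by (cases q) auto
  obtain x where e: "e = (u, x)" using Cons.prems(1) by (cases e) (auto simp: apath_Cons_iff)
  obtain y where f: "f = (u, y)"
    using Cons.prems(2) q by (cases f) (auto simp: apath_Cons_iff)
  have P: "(u, x) \<in> parcs T" "apath x p v" "u \<notin> set (pawalk_verts x p)"
    using Cons.prems(1) by (auto simp: e apath_Cons_iff)
  have Q: "(u, y) \<in> parcs T" "apath y q' v" "u \<notin> set (pawalk_verts y q')"
    using Cons.prems(2) by (auto simp: q f apath_Cons_iff)
  show ?case
  proof (cases "x = y")
    case True
    then show ?thesis using Cons.IH[OF P(2)] Q(2) by (simp add: q e f)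
  next
    case False
    define w where "w = p @ rev_path q'"
    have wv: "awalk v (rev_path q') y" using Q(2) by (simp add: awalkI_apath)
    have wx: "awalk x w y"
      unfolding w_def using awalk_appendI[OF awalkI_apath[OF P(2)] wv] .
    have "u \<notin> set (pawalk_verts v (rev_path q'))"
      using Q(2,3) awalk_verts_rev_path[OF awalkI_apath[OF Q(2)]] by simp
    then have uw: "u \<notin> set (pawalk_verts x w)"
      using set_awalk_verts_append[OF awalkI_apath[OF P(2)] wv] P(3) by (simp add: w_def)
    \<comment> \<open>\<open>p\<close> and \<open>q'\<close> may meet before \<open>v\<close>, so
      \<open>w\<close> can repeat vertices; the cycle needs a path from \<open>x\<close> to
      \<open>y\<close>.\<close>
    define r where "r = awalk_to_apath w"
    have r: "apath x r y" unfolding r_def using wx by (rule apath_awalk_to_apath)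
    have "set r \<subseteq> set w" unfolding r_def using wx by (rule awalk_to_apath_subset)
    moreover have "x \<noteq> u" using hd_in_awalk_verts(2)[OF P(2)] P(3) by auto
    ultimately have ur: "u \<notin> set (pawalk_verts x r)"
      using uw set_awalk_verts[OF wx] set_awalk_verts[OF awalkI_apath[OF r]] by auto
    have "r \<noteq> []" using r False by (auto simp: apath_Nil_iff)
    have yu: "(y, u) \<in> parcs T" using Q(1) arcs_symmetric by blast
    have aw: "awalk x (r @ [(y, u)]) u"
      using awalk_appendI[OF awalkI_apath[OF r]] arc_implies_awalk[OF yu] by simp
    have "pawalk_verts x (r @ [(y, u)]) = pawalk_verts x r @ [u]"
      using awalk_verts_append[OF aw] by simp
    then have "distinct (pawalk_verts x (r @ [(y, u)]))"
      using r ur by (simp add: apath_def)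
    then have "cycle ((u, x) # r @ [(y, u)])"
      unfolding cycle_def using aw P(1) by (intro exI[of _ u]) (simp add: awalk_Cons_iff del: awalk_append_iff)
    \<comment> \<open>\<open>r\<close> is nonempty because \<open>x\<close> and \<open>y\<close>
      differ; this excludes the closed walk of length 2 along a single edge.\<close>
    moreover have "3 \<le> length ((u, x) # r @ [(y, u)])"
      using \<open>r \<noteq> []\<close> by (cases r) auto
    ultimately have False using is_tree unfolding undirected_tree_def by blast
    then show ?thesis ..
  qed
qed

text \<open>Uniqueness turns the existence of a proper path between two vertices into properness of
  every path, which is how the lower bound uses the coloring.\<close>

lemma apath_distance2_proper:
  assumes "distance2_proper_connected T c" "apath u p v"
  shows "distance2_proper c p"
proof (cases "u = v")
  case True
  then have "p = []" using assms(2) apath_nonempty_ends by blast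
  then show ?thesis by (simp add: distance2_proper_def)
next
  case False
  have "u \<in> pverts T" "v \<in> pverts T"
    using awalkI_apath[OF assms(2)] awalk_hd_in_verts awalk_last_in_verts by auto
  then obtain q where "apath u q v" "distance2_proper c q"
    using assms(1) False unfolding distance2_proper_connected_def by blast
  then show ?thesis using apath_unique[OF assms(2)] by simp
qed

section \<open>Lower bound: edges meeting a fixed edge\<close>

text \<open>Arcs come in symmetric pairs, so these are all edges incident with \<open>x\<close>,
  although only arcs leaving \<open>x\<close> are taken.\<close>

definition star :: "'a \<Rightarrow> 'a set set" where
  "star x = edge_of ` out_arcs (with_proj T) x"

lemma mem_star_iff: "e \<in> star x \<longleftrightarrow> (\<exists>a. (x, a) \<in> parcs T \<and> e = {x, a})"
  by (force simp: star_def edge_of_def)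

lemma star_subset: "star x \<subseteq> uedges T"
  by (auto simp: star_def uedges_def)

lemma star_cover: "(x, y) \<in> parcs T \<Longrightarrow> {x, y} \<in> star x \<inter> star y"
  using arcs_symmetric[of x y] by (auto simp: mem_star_iff)

lemma finite_star: "finite (star x)"
  unfolding star_def by blast

lemma finite_uedges: "finite (uedges T)"
  unfolding uedges_def using pair_finite_arcs by simp

lemma card_star: "card (star x) = out_degree (with_proj T) x"
  unfolding star_def out_degree_def
  by (rule card_image) (auto simp: inj_on_def edge_of_def doubleton_eq_iff)

text \<open>The two stars share exactly the edge joining \<open>x\<close> and \<open>y\<close>; this
  overlap is the \<open>- 1\<close> of the theorem.\<close>

lemma card_two_stars:
  assumes "(x, y) \<in> parcs T"
  shows "card (star x \<union> star y) = out_degree (with_proj T) x + out_degree (with_proj T) y - 1"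
proof -
  have "x \<noteq> y" using assms no_loops' by blast
  have "star x \<inter> star y = {{x, y}}"
  proof
    show "star x \<inter> star y \<subseteq> {{x, y}}"
      using \<open>x \<noteq> y\<close> by (auto simp: mem_star_iff doubleton_eq_iff)
    show "{{x, y}} \<subseteq> star x \<inter> star y" using star_cover[OF assms] by simp
  qed
  then show ?thesis
    using card_Un_Int[OF finite_star finite_star, of x y] card_star by simp
qed

text \<open>Two edges at \<open>x\<close> are consecutive on the path \<open>a\<close>,
  \<open>x\<close>, \<open>b\<close>.\<close>

lemma inj_on_star:
  assumes "distance2_proper_connected T c"
  shows "inj_on c (star x)"
proof (rule inj_onI, rule ccontr)
  fix e f assume *: "e \<in> star x" "f \<in> star x" "c e = c f" "e \<noteq> f"
  then obtain a b where ab: "(x, a) \<in> parcs T" "e = {x, a}" "(x, b) \<in> parcs T" "f = {x, b}"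
    by (auto simp: mem_star_iff)
  have "a \<noteq> b" using ab * by auto
  have "apath a [(a, x), (x, b)] b"
    using ab \<open>a \<noteq> b\<close> arcs_symmetric no_loops' in_arcsD2 by (auto simp: apath_simps)
  from apath_distance2_proper[OF assms this] have "c {a, x} \<noteq> c {x, b}"
    unfolding distance2_proper_def edge_of_def by (force dest: spec[of _ 0] spec[of _ "Suc 0"])
  then show False using * ab by (simp add: insert_commute)
qed

text \<open>Pairs inside one star are already settled. An edge at \<open>x\<close> and an edge at
  \<open>y\<close> outside the common edge are the first and last of a path \<open>a\<close>,
  \<open>x\<close>, \<open>y\<close>, \<open>b\<close>, with just one edge in between.\<close>

lemma inj_on_two_stars:
  assumes c: "distance2_proper_connected T c" and xy: "(x, y) \<in> parcs T"
  shows "inj_on c (star x \<union> star y)"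
proof -
  have "c e \<noteq> c f" if e: "e \<in> star x" "e \<notin> star y" and f: "f \<in> star y" "f \<notin> star x" for e f
  proof -
    obtain a b where ab: "(x, a) \<in> parcs T" "e = {x, a}" "(y, b) \<in> parcs T" "f = {y, b}"
      using e f by (auto simp: mem_star_iff)
    have "a \<noteq> y" "b \<noteq> x" using ab e f star_cover[OF xy] by (auto simp: insert_commute)
    have arcs: "(a, x) \<in> parcs T" "x \<noteq> y" "a \<noteq> x" "y \<noteq> b"
      using ab xy arcs_symmetric no_loops' by auto
    have v: "y \<in> pverts T" "b \<in> pverts T" using ab in_arcsD1 in_arcsD2 by auto
    \<comment> \<open>Otherwise \<open>a\<close>, \<open>x\<close>, \<open>y\<close> form a
      triangle, which gives two paths from \<open>a\<close> to \<open>y\<close>.\<close>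
    have "a \<noteq> b"
    proof
      assume "a = b"
      then have "apath a [(a, y)] y" "apath a [(a, x), (x, y)] y"
        using ab arcs xy v \<open>a \<noteq> y\<close> arcs_symmetric by (auto simp: apath_simps)
      then show False using apath_unique by blast
    qed
    then have "apath a [(a, x), (x, y), (y, b)] b"
      using ab arcs xy v \<open>a \<noteq> y\<close> \<open>b \<noteq> x\<close> by (auto simp: apath_simps)
    from apath_distance2_proper[OF c this] have "c {a, x} \<noteq> c {y, b}"
      unfolding distance2_proper_def edge_of_def
      by (force dest: spec[of _ 0] spec[of _ "Suc (Suc 0)"])
    then show ?thesis using ab by (simp add: insert_commute)
  qed
  then show ?thesis
    using inj_on_star[OF c, of x] inj_on_star[OF c, of y]
    unfolding inj_on_def by (metis UnE)
qed

section \<open>Rooting the tree\<close>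

text \<open>If \<open>w\<close> is not on \<open>p\<close>, then \<open>p\<close> followed by the
  arc is a path to \<open>w\<close>, hence equals \<open>q\<close>. If it is, the part of
  \<open>p\<close> after \<open>w\<close> is a path from \<open>w\<close> to \<open>v\<close>, hence
  the single arc.\<close>

lemma apath_extends_across_arc:
  assumes p: "apath r p v" and q: "apath r q w" and vw: "(v, w) \<in> parcs T"
  shows "q = p @ [(v, w)] \<or> p = q @ [(w, v)]"
proof (cases "w \<in> set (pawalk_verts r p)")
  case False
  have "w \<in> pverts T" "v \<noteq> w" using vw in_arcsD2 no_loops' by auto
  moreover have "last (pawalk_verts r p) = v" using awalkI_apath[OF p] by blast
  ultimately have "apath r (p @ [(v, w)]) w"
    using p vw False by (auto simp: apath_append_iff apath_simps)
  then show ?thesis using apath_unique q by blast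
next
  case True
  then obtain s t where st: "p = s @ t" "awalk r s w" "awalk w t v"
    using awalk_decomp[OF awalkI_apath[OF p]] by blast
  moreover have "last (pawalk_verts r s) = w" using st(2) by blast
  ultimately have "apath r s w" "apath w t v"
    using p by (auto simp: apath_append_iff)
  moreover have "v \<in> pverts T" "v \<noteq> w" using vw in_arcsD1 no_loops' by auto
  then have "apath w [(w, v)] v" using arcs_symmetric[OF vw] by (simp add: apath_simps)
  ultimately show ?thesis using apath_unique q st by blast
qed

text \<open>Depth is the length of the unique path from a chosen root. The second property says that
  a vertex has at most one shallower neighbour, its parent.\<close>

lemma ex_depth:
  obtains depth :: "'a \<Rightarrow> nat" where
    "\<And>u v. (u, v) \<in> parcs T \<Longrightarrow> depth v = Suc (depth u) \<or> depth u = Suc (depth v)"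
    "\<And>u v w. (u, v) \<in> parcs T \<Longrightarrow> (w, v) \<in> parcs T \<Longrightarrow>
       depth u < depth v \<Longrightarrow> depth w < depth v \<Longrightarrow> u = w"
proof (cases "pverts T = {}")
  case True
  then show ?thesis using that[of "\<lambda>_. 0"] in_arcsD1 by blast
next
  case False
  then obtain r where r: "r \<in> pverts T" by auto
  define P where "P v = (SOME p. apath r p v)" for v
  have P: "apath r (P v) v" if "v \<in> pverts T" for v
    unfolding P_def using ex_apath[OF r that] by (metis someI)
  have step: "P v = P u @ [(u, v)] \<or> P u = P v @ [(v, u)]" if "(u, v) \<in> parcs T" for u v
    using apath_extends_across_arc[OF P P that] that in_arcsD1 in_arcsD2 by blast
  show ?thesis
  proof (rule that[of "\<lambda>v. length (P v)"])
    fix u v assume "(u, v) \<in> parcs T"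
    then show "length (P v) = Suc (length (P u)) \<or> length (P u) = Suc (length (P v))"
      using step by fastforce
  next
    fix u v w
    assume "(u, v) \<in> parcs T" "(w, v) \<in> parcs T"
      "length (P u) < length (P v)" "length (P w) < length (P v)"
    \<comment> \<open>The lengths rule out the other alternative of \<open>step\<close>; the last
      arc of \<open>P v\<close> then determines the parent.\<close>
    then have "P v = P u @ [(u, v)]" "P v = P w @ [(w, v)]"
      using step by fastforce+
    then show "u = w" by simp
  qed
qed

section \<open>Upper bound: coloring outwards from the root\<close>

definition near :: "'a set \<Rightarrow> 'a set \<Rightarrow> bool" where
  "near e f \<longleftrightarrow> (\<exists>x \<in> e. \<exists>y \<in> f. x = y \<or> (x, y) \<in> parcs T)"

lemma near_sym: "near e f \<Longrightarrow> near f e"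
  unfolding near_def using arcs_symmetric by blast

text \<open>Edges one position apart on a path share a vertex, and edges two positions apart are
  joined by the path edge between them. Both pairs are near, so any path between the two vertices is
  proper.\<close>

lemma distance2_proper_connectedI:
  assumes c: "\<And>e f. e \<in> uedges T \<Longrightarrow> f \<in> uedges T \<Longrightarrow> e \<noteq> f \<Longrightarrow> near e f \<Longrightarrow> c e \<noteq> c f"
  shows "distance2_proper_connected T c"
  unfolding distance2_proper_connected_def
proof (intro ballI impI)
  fix u v assume "u \<in> pverts T" "v \<in> pverts T"
  then obtain p where p: "apath u p v" using ex_apath by blast
  have cas: "pcas u p v" and sub: "set p \<subseteq> parcs T" and dist: "distinct (pawalk_verts u p)"
    using p by (auto simp: apath_def)
  have len: "length (pawalk_verts u p) = Suc (length p)" by (rule length_awalk_verts)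
  have fst_nth: "fst (p ! i) = pawalk_verts u p ! i" if "i < length p" for i
    using that awalk_verts_conv[of u p] by (auto simp: nth_append)
  have snd_nth: "snd (p ! i) = pawalk_verts u p ! Suc i" if "i < length p" for i
    using that awalk_verts_conv'[OF cas] by (auto simp: nth_append)
  have "c (edge_of (p ! i)) \<noteq> c (edge_of (p ! j))"
    if ij: "i < j" "j < length p" "j - i - 1 < 2" for i j
  proof (rule c)
    have arc: "p ! m \<in> parcs T" if "m < length p" for m using sub that by auto
    then show "edge_of (p ! i) \<in> uedges T" "edge_of (p ! j) \<in> uedges T"
      using ij by (auto simp: uedges_def)
    \<comment> \<open>The start of edge \<open>i\<close> is vertex \<open>i\<close> of the path,
      while edge \<open>j\<close> has the later vertices \<open>j\<close> and
      \<open>j + 1\<close>.\<close>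
    have "fst (p ! i) \<noteq> fst (p ! j)" "fst (p ! i) \<noteq> snd (p ! j)"
      using ij dist len fst_nth snd_nth by (auto simp: nth_eq_iff_index_eq)
    then show "edge_of (p ! i) \<noteq> edge_of (p ! j)" by (auto simp: edge_of_def)
    have "j = Suc i \<or> j = Suc (Suc i)" using ij by linarith
    then show "near (edge_of (p ! i)) (edge_of (p ! j))"
    proof
      assume "j = Suc i"
      then have "snd (p ! i) = fst (p ! j)" using ij fst_nth snd_nth by simp
      then show ?thesis by (auto simp: near_def edge_of_def)
    next
      assume j: "j = Suc (Suc i)"
      then have "p ! Suc i = (snd (p ! i), fst (p ! j))"
        using ij fst_nth snd_nth by (simp add: prod_eq_iff)
      then have "(snd (p ! i), fst (p ! j)) \<in> parcs T" using arc[of "Suc i"] ij j by simp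
      then show ?thesis by (auto simp: near_def edge_of_def)
    qed
  qed
  then have "distance2_proper c p" unfolding distance2_proper_def by blast
  then show "\<exists>p. apath u p v \<and> distance2_proper c p" using p by blast
qed

text \<open>
  Edges are colored from the root outwards. When the edge from \<open>u\<close> to its child is reached, the
  colored edges near it all meet \<open>u\<close> or the parent of \<open>u\<close>.
\<close>

lemma ex_coloring:
  assumes bound: "\<And>x y. (x, y) \<in> parcs T \<Longrightarrow>
      out_degree (with_proj T) x + out_degree (with_proj T) y \<le> Suc k"
  shows "\<exists>c. c ` uedges T \<subseteq> {..<k} \<and> distance2_proper_connected T c"
proof -
  obtain depth :: "'a \<Rightarrow> nat" where
    d1: "\<And>u v. (u, v) \<in> parcs T \<Longrightarrow> depth v = Suc (depth u) \<or> depth u = Suc (depth v)" and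
    d2: "\<And>u v w. (u, v) \<in> parcs T \<Longrightarrow> (w, v) \<in> parcs T \<Longrightarrow>
       depth u < depth v \<Longrightarrow> depth w < depth v \<Longrightarrow> u = w"
    using ex_depth by blast
  have oriented: "\<exists>u v. e = {u, v} \<and> (u, v) \<in> parcs T \<and> depth v = Suc (depth u)"
    if "e \<in> uedges T" for e
  proof -
    obtain a b where ab: "(a, b) \<in> parcs T" "e = {a, b}"
      using \<open>e \<in> uedges T\<close> by (auto simp: uedges_def edge_of_def)
    then show ?thesis using d1[OF ab(1)] arcs_symmetric[OF ab(1)] by (metis insert_commute)
  qed
  \<comment> \<open>For an edge with upper endpoint \<open>u\<close> this is
    \<open>2 * depth u + 1\<close>, so ranking edges by it orders them by the depth of their upper
    endpoint.\<close>
  let ?rank = "sum depth"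
  have "card {f \<in> uedges T. f \<noteq> e \<and> near e f \<and> ?rank f \<le> ?rank e} < k" if e: "e \<in> uedges T" for e
  proof -
    obtain u v where uv: "e = {u, v}" "(u, v) \<in> parcs T" "depth v = Suc (depth u)"
      using oriented[OF e] by blast
    \<comment> \<open>\<open>w\<close> is the parent of \<open>u\<close>; if \<open>u\<close> has no
      shallower neighbour, any neighbour such as \<open>v\<close> will do, since
      \<open>parent\<close> is then vacuous.\<close>
    obtain w where w: "(u, w) \<in> parcs T"
      and parent: "\<And>y. (y, u) \<in> parcs T \<Longrightarrow> depth y < depth u \<Longrightarrow> y = w"
      using d2 uv(2) arcs_symmetric by blast
    have "f \<in> star u \<union> star w"
      if f: "f \<in> uedges T" "near e f" "?rank f \<le> ?rank e" for f
    proof -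
      obtain u' v' where f': "f = {u', v'}" "(u', v') \<in> parcs T" "depth v' = Suc (depth u')"
        using oriented[OF f(1)] by blast
      have "u \<noteq> v" "u' \<noteq> v'" using uv f' by auto
      then have le: "depth u' \<le> depth u" using f(3) uv f' by simp
      obtain x y where xy: "x \<in> {u, v}" "y \<in> {u', v'}" "x = y \<or> (x, y) \<in> parcs T"
        using f(2) uv f' unfolding near_def by blast
      have "(v', u') \<in> parcs T" using f'(2) arcs_symmetric by blast
      \<comment> \<open>Since \<open>u'\<close> is no deeper than \<open>u\<close>, the vertex
        \<open>y\<close> is \<open>u\<close>, its parent \<open>w\<close>, or a child of
        \<open>u\<close>. In the last case \<open>y\<close> is \<open>v'\<close>, whose only
        shallower neighbour is \<open>u'\<close>, so \<open>u' = u\<close>.\<close>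
      have "u \<in> f \<or> w \<in> f"
      proof (cases "x = y")
        case True
        then show ?thesis using xy uv f' le d2[of u v u'] by auto
      next
        case False
        then have arc: "(x, y) \<in> parcs T" "(y, x) \<in> parcs T" using xy arcs_symmetric by auto
        show ?thesis
        proof (cases "depth y < depth x")
          case True
          then show ?thesis using xy arc parent[of y] uv f' d2[of u v y] by auto
        next
          case False
          then have "depth y = Suc (depth x)" using d1[OF arc(1)] by auto
          then show ?thesis using xy arc uv f' le d2[of u v' u'] by auto
        qed
      qed
      then show ?thesis using star_cover[OF f'(2)] f'(1) star_cover[OF \<open>(v', u') \<in> parcs T\<close>]
        by auto
    qed
    then have "{f \<in> uedges T. f \<noteq> e \<and> near e f \<and> ?rank f \<le> ?rank e} \<subseteq> (star u \<union> star w) - {e}"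
      by blast
    then have "card {f \<in> uedges T. f \<noteq> e \<and> near e f \<and> ?rank f \<le> ?rank e}
        \<le> card ((star u \<union> star w) - {e})"
      by (intro card_mono) (auto simp: finite_star)
    \<comment> \<open>\<open>e\<close> itself lies in \<open>star u\<close>; discarding it gives the
      strict inequality that leaves a free color.\<close>
    also have "\<dots> < card (star u \<union> star w)"
      using star_cover[OF uv(2)] uv(1) by (intro card_Diff1_less) (auto simp: finite_star)
    also have "\<dots> \<le> k" using card_two_stars[OF w] bound[OF w] by simp
    finally show ?thesis .
  qed
  from greedy_coloring[of "uedges T" near ?rank k, OF finite_uedges near_sym this]
  obtain c where c: "c ` uedges T \<subseteq> {..<k}"
    "\<forall>e \<in> uedges T. \<forall>f \<in> uedges T. e \<noteq> f \<longrightarrow> near e f \<longrightarrow> c e \<noteq> c f"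
    by blast
  then have "distance2_proper_connected T c" by (intro distance2_proper_connectedI) blast
  then show ?thesis using c(1) by blast
qed

lemma ex_arc:
  assumes "2 \<le> card (pverts T)"
  shows "parcs T \<noteq> {}"
proof -
  obtain u v where "u \<in> pverts T" "v \<in> pverts T" "u \<noteq> v"
    using assms by (meson card_2_iff' obtain_subset_with_card_n subsetD)
  moreover from this obtain p where p: "apath u p v" using ex_apath by blast
  ultimately have "p \<noteq> []" by (auto simp: apath_Nil_iff)
  then show ?thesis using p by (auto simp: apath_def awalk_def neq_Nil_conv)
qed

end

section \<open>Combining the two bounds\<close>

theorem theorem2p4:
  fixes T :: "'a pair_pre_digraph"
  assumes "nontrivial_tree T"
  shows "pc12 T = sigma2' T - 1"
proof -
  interpret pair_graph T
    using assms by (simp add: nontrivial_tree_def undirected_tree_def)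
  interpret tree_graph T
    using assms by unfold_locales (simp add: nontrivial_tree_def)
  define D where
    "D = {out_degree (with_proj T) x + out_degree (with_proj T) y | x y. (x, y) \<in> parcs T}"
  have "D = (\<lambda>(x, y). out_degree (with_proj T) x + out_degree (with_proj T) y) ` parcs T"
    unfolding D_def by auto
  then have D: "finite D" "D \<noteq> {}"
    using ex_arc assms pair_finite_arcs by (auto simp: nontrivial_tree_def)
  have sigma: "sigma2' T = Max D" by (simp add: sigma2'_def D_def)
  have lower: "sigma2' T - 1 \<le> card (c ` uedges T)" if c: "distance2_proper_connected T c" for c
  proof -
    have "sigma2' T \<in> D" using Max_in[OF D] sigma by simp
    then obtain x y where xy: "(x, y) \<in> parcs T"
      "sigma2' T = out_degree (with_proj T) x + out_degree (with_proj T) y"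
      unfolding D_def by blast
    then have "sigma2' T - 1 = card (star x \<union> star y)" using card_two_stars by simp
    also have "\<dots> = card (c ` (star x \<union> star y))"
      using inj_on_two_stars[OF c xy(1)] by (simp add: card_image)
    also have "\<dots> \<le> card (c ` uedges T)"
      using star_subset finite_uedges by (intro card_mono image_mono finite_imageI) auto
    finally show ?thesis .
  qed
  have "out_degree (with_proj T) x + out_degree (with_proj T) y \<le> Suc (sigma2' T - 1)"
    if "(x, y) \<in> parcs T" for x y
    using Max_ge[OF D(1), of "out_degree (with_proj T) x + out_degree (with_proj T) y"] that
    unfolding sigma by (fastforce simp: D_def)
  from ex_coloring[OF this] obtain c where
    c: "c ` uedges T \<subseteq> {..<sigma2' T - 1}" "distance2_proper_connected T c"
    by blast
  \<comment> \<open>\<open>pc12\<close> asks for exactly this many colors: the range of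
    \<open>c\<close> gives at most, the lower bound applied to \<open>c\<close> itself gives at
    least.\<close>
  have "card (c ` uedges T) = sigma2' T - 1"
    using card_mono[OF _ c(1)] lower[OF c(2)] by simp
  then show ?thesis
    unfolding pc12_def using c(2) lower by (intro Least_equality) auto
qed

end
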